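(* Let $p\geq 1$ be a real number and for each integer $n\ge 1$ let $K_n^{p}=\{(x_1,\dots,x_n)\in\mathbb{R}^n: |x_1|^p+|x_2|^p+\cdots+|x_n|^p\leq 1\}$. Let $c_3=0.2056\cdots$ be the solution of $\frac{1}{2^{1-c}}\cdot\frac{(1+c)^{1+c}}{c^c}=1$, and let $c_4=0.2271\cdots$ be the solution in $(0,1)$ of $\frac{1}{2^{1-c}}\cdot\frac{1}{c^c\,(1-c)^{1-c}}=1$. Then there exists a real number $c_2$ with $c_3\leq c_2\leq c_4$ such that $$\lim_{n\to\infty}\gamma_{2^n}(K_n^{p})\leq \left(\frac{1}{1+c_2}\right)^{\frac1p}.$$
   Context: For a convex body $K\subset\mathbb{R}^n$ (a compact convex set with non-empty interior) and a positive integer $m$, Hadwiger's covering functional is $$\gamma_m(K)=\min\Big\{\lambda>0:\ \exists\, u_1,\dots,u_m\in\mathbb{R}^n \text{ such that } K\subseteq \bigcup_{i=1}^m(\lambda K+u_i)\Big\},$$ i.e. the smallest $\lambda$ such that $K$ can be covered by $m$ translates of $\lambda K$. *)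

theory Defs
  imports Complex_Main "Jordan_Normal_Form.Matrix"
begin

text \<open>
  The dimension varies within the limit, so a point of n-dimensional real space is a
  \<^typ>\<open>real vec\<close> in \<^term>\<open>carrier_vec n\<close>.
\<close>

text \<open>
  The minimum over \<open>\<lambda>\<close> is rendered literally by \<^const>\<open>Least\<close>; it is attained for every
  convex body with n, m at least 1. The translation vectors need not be distinct.
\<close>

definition covered_by_translates :: "nat \<Rightarrow> nat \<Rightarrow> real vec set \<Rightarrow> real \<Rightarrow> bool" where
  "covered_by_translates n m K l \<longleftrightarrow>
     (\<exists>u. (\<forall>i\<in>{1..m}. u i \<in> carrier_vec n) \<and>
          K \<subseteq> (\<Union>i\<in>{1..m}. (\<lambda>x. l \<cdot>\<^sub>v x + u i) ` K))"

definition covering_functional :: "nat \<Rightarrow> nat \<Rightarrow> real vec set \<Rightarrow> real" where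
  "covering_functional n m K = (LEAST l. 0 < l \<and> covered_by_translates n m K l)"

definition lp_ball :: "real \<Rightarrow> nat \<Rightarrow> real vec set" where
  "lp_ball p n = {x \<in> carrier_vec n. (\<Sum>i<n. \<bar>x $ i\<bar> powr p) \<le> 1}"

definition c3_eq :: "real \<Rightarrow> bool" where
  "c3_eq c \<longleftrightarrow>
     1 / 2 powr (1 - c) * ((1 + c) powr (1 + c) / c powr c) = 1"

definition c4_eq :: "real \<Rightarrow> bool" where
  "c4_eq c \<longleftrightarrow>
     1 / 2 powr (1 - c) * (1 / (c powr c * (1 - c) powr (1 - c))) = 1"

definition c3 :: real where
  "c3 = (THE c. 0 < c \<and> c3_eq c)"

text \<open>The restriction to c < 1 matters: the left-hand side also tends to 1 as c tends to 1.\<close>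

definition c4 :: real where
  "c4 = (THE c. 0 < c \<and> c < 1 \<and> c4_eq c)"

lemma c3_eq_iff:
  assumes "0 < c"
  shows "c3_eq c \<longleftrightarrow> (1 + c) * ln (1 + c) - c * ln c - (1 - c) * ln 2 = 0" (is "_ \<longleftrightarrow> ?f = 0")
proof -
  have "1 / 2 powr (1 - c) * ((1 + c) powr (1 + c) / c powr c) = exp ?f"
    using assms by (simp add: powr_def exp_diff)
  then show ?thesis by (simp add: c3_eq_def)
qed

lemma c4_eq_iff:
  assumes "0 < c" "c < 1"
  shows "c4_eq c \<longleftrightarrow> - (c * ln c) - (1 - c) * ln (1 - c) - (1 - c) * ln 2 = 0" (is "_ \<longleftrightarrow> ?g = 0")
proof -
  have "1 / 2 powr (1 - c) * (1 / (c powr c * (1 - c) powr (1 - c))) = exp ?g"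
    using assms by (simp add: powr_def exp_diff exp_minus exp_add field_simps)
  then show ?thesis by (simp add: c4_eq_def)
qed

lemma c3_unique: "\<exists>!c. 0 < c \<and> c3_eq c"
  and c3_props: "0 < c3" "c3_eq c3" "0.2054 < c3" "c3 < 0.2059"
proof -
  define f :: "real \<Rightarrow> real" where "f = (\<lambda>c. (1 + c) * ln (1 + c) - c * ln c - (1 - c) * ln 2)"
  have d: "(f has_real_derivative (ln (1 + c) - ln c + ln 2)) (at c)" if "0 < c" for c
    unfolding f_def using that by (auto intro!: derivative_eq_intros)
  have pos: "ln (1 + c) - ln c + ln 2 > 0" if "0 < c" for c :: real
  proof -
    have "ln c < ln (1 + c)" using that by simp
    then show ?thesis using ln_gt_zero[of "2::real"] by linarith
  qed
  have mono: "f a < f b" if "0 < a" "a < b" for a b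
  proof (rule DERIV_pos_imp_increasing[OF that(2)])
    fix x assume "a \<le> x" "x \<le> b"
    then have "0 < x" using that by simp
    then show "\<exists>y. (f has_real_derivative y) (at x) \<and> 0 < y"
      using d pos by blast
  qed
  have lo: "f (15/73) < 0"
  proof -
    have "(88::real)^88 < 73^73 * 15^15 * 2^58" by simp
    then have "ln ((88::real)^88) < ln (73^73 * 15^15 * 2^58)"
      by (subst ln_less_cancel_iff)
        (simp_all only: zero_less_mult_iff zero_less_power zero_less_numeral simp_thms)
    then have "88 * ln (88::real) < 73 * ln 73 + 15 * ln 15 + 58 * ln 2"
      by (simp only: ln_mult_pos ln_realpow zero_less_power zero_less_numeral
          zero_less_mult_iff simp_thms of_nat_numeral)
    then show ?thesis unfolding f_def by (simp add: ln_div field_simps)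
  qed
  have hi: "f (7/34) > 0"
  proof -
    have "(34::real)^34 * 7^7 * 2^27 < 41^41" by simp
    then have "ln ((34::real)^34 * 7^7 * 2^27) < ln (41^41)"
      by (subst ln_less_cancel_iff)
        (simp_all only: zero_less_mult_iff zero_less_power zero_less_numeral simp_thms)
    then have "34 * ln (34::real) + 7 * ln 7 + 27 * ln 2 < 41 * ln 41"
      by (simp only: ln_mult_pos ln_realpow zero_less_power zero_less_numeral
          zero_less_mult_iff simp_thms of_nat_numeral)
    then show ?thesis unfolding f_def by (simp add: ln_div field_simps)
  qed
  have "\<exists>x\<ge>15/73. x \<le> 7/34 \<and> f x = 0"
  proof (rule IVT)
    show "\<forall>x. 15/73 \<le> x \<and> x \<le> 7/34 \<longrightarrow> isCont f x"
      using DERIV_isCont[OF d] by simp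
  qed (use lo hi in auto)
  then obtain r where r: "15/73 \<le> r" "r \<le> 7/34" "f r = 0" by blast
  have iff: "c3_eq c \<longleftrightarrow> f c = 0" if "0 < c" for c
    using c3_eq_iff[OF that] by (simp add: f_def)
  have uniq: "c = r" if "0 < c \<and> c3_eq c" for c
    using that r iff mono[of c r] mono[of r c] by (cases c r rule: linorder_cases) auto
  have sol: "0 < r \<and> c3_eq r" using r iff by simp
  show "\<exists>!c. 0 < c \<and> c3_eq c" using sol uniq by blast
  have "c3 = r" unfolding c3_def using sol uniq by (rule the_equality)
  then show "0 < c3" "c3_eq c3" "0.2054 < c3" "c3 < 0.2059" using sol r by auto
qed

lemma c4_unique: "\<exists>!c. 0 < c \<and> c < 1 \<and> c4_eq c"
  and c4_props: "0 < c4" "c4 < 1" "c4_eq c4" "0.2266 < c4" "c4 < 0.2273"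
proof -
  define g :: "real \<Rightarrow> real"
    where "g = (\<lambda>c. - (c * ln c) - (1 - c) * ln (1 - c) - (1 - c) * ln 2)"
  have d: "(g has_real_derivative (ln (1 - c) - ln c + ln 2)) (at c)" if "0 < c" "c < 1" for c
    unfolding g_def using that by (auto intro!: derivative_eq_intros)
  have pos: "ln (1 - c) - ln c + ln 2 > 0" if "0 < c" "c \<le> 1/2" for c :: real
  proof -
    have "ln c \<le> ln (1 - c)" using that by simp
    then show ?thesis using ln_gt_zero[of "2::real"] by linarith
  qed
  have mono: "g a < g b" if "0 < a" "a < b" "b \<le> 1/2" for a b
  proof (rule DERIV_pos_imp_increasing[OF that(2)])
    fix x assume "a \<le> x" "x \<le> b"
    then have "0 < x" "x < 1" "x \<le> 1/2" using that by auto
    then show "\<exists>y. (g has_real_derivative y) (at x) \<and> 0 < y"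
      using d pos by blast
  qed
  have right: "g c > 0" if "1/2 \<le> c" "c < 1" for c
  proof -
    have "c * ln c < 0" using that by (simp add: mult_pos_neg)
    moreover have "(1 - c) * (ln (1 - c) + ln 2) \<le> 0"
    proof -
      have "ln (1 - c) + ln 2 = ln ((1 - c) * 2)" using that by (intro ln_mult_pos[symmetric]) simp_all
      also have "\<dots> \<le> 0" using that by simp
      finally show ?thesis using that by (simp add: mult_nonneg_nonpos)
    qed
    ultimately show ?thesis unfolding g_def by (simp add: algebra_simps)
  qed
  have lo: "g (17/75) < 0"
  proof -
    have "(75::real)^75 < 17^17 * 58^58 * 2^58" by simp
    then have "ln ((75::real)^75) < ln (17^17 * 58^58 * 2^58)"
      by (subst ln_less_cancel_iff)
        (simp_all only: zero_less_mult_iff zero_less_power zero_less_numeral simp_thms)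
    then have "75 * ln (75::real) < 17 * ln 17 + 58 * ln 58 + 58 * ln 2"
      by (simp only: ln_mult_pos ln_realpow zero_less_power zero_less_numeral
          zero_less_mult_iff simp_thms of_nat_numeral)
    then show ?thesis unfolding g_def by (simp add: ln_div field_simps)
  qed
  have hi: "g (5/22) > 0"
  proof -
    have "(5::real)^5 * 17^17 * 2^17 < 22^22" by simp
    then have "ln ((5::real)^5 * 17^17 * 2^17) < ln (22^22)"
      by (subst ln_less_cancel_iff)
        (simp_all only: zero_less_mult_iff zero_less_power zero_less_numeral simp_thms)
    then have "5 * ln (5::real) + 17 * ln 17 + 17 * ln 2 < 22 * ln 22"
      by (simp only: ln_mult_pos ln_realpow zero_less_power zero_less_numeral
          zero_less_mult_iff simp_thms of_nat_numeral)
    then show ?thesis unfolding g_def by (simp add: ln_div field_simps)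
  qed
  have "\<exists>x\<ge>17/75. x \<le> 5/22 \<and> g x = 0"
  proof (rule IVT)
    show "\<forall>x. 17/75 \<le> x \<and> x \<le> 5/22 \<longrightarrow> isCont g x"
      using DERIV_isCont[OF d] by simp
  qed (use lo hi in auto)
  then obtain r where r: "17/75 \<le> r" "r \<le> 5/22" "g r = 0" by blast
  have iff: "c4_eq c \<longleftrightarrow> g c = 0" if "0 < c" "c < 1" for c
    using c4_eq_iff[OF that] by (simp add: g_def)
  have uniq: "c = r" if c: "0 < c \<and> c < 1 \<and> c4_eq c" for c
  proof -
    have z: "g c = 0" using c iff by blast
    then have "c \<le> 1/2" using right[of c] c by force
    then show ?thesis
      using c z r mono[of c r] mono[of r c] by (cases c r rule: linorder_cases) auto
  qed
  have sol: "0 < r \<and> r < 1 \<and> c4_eq r" using r iff by simp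
  show "\<exists>!c. 0 < c \<and> c < 1 \<and> c4_eq c" using sol uniq by blast
  have "c4 = r" unfolding c4_def using sol uniq by (rule the_equality)
  then show "0 < c4" "c4 < 1" "c4_eq c4" "0.2266 < c4" "c4 < 0.2273" using sol r by auto
qed

end

theory Submission
  imports Defs "HOL-Analysis.Function_Topology"
begin

text \<open>
  Measure errors by the \<open>p\<close>-mass, the sum of the \<open>p\<close>-th powers of the coordinates, and let
  \<open>r\<^sub>n\<close> be the \<open>p\<close>-th power of the covering functional for \<open>2 ^ n\<close> translates.

  The limit exists because a covering in a large dimension \<open>n\<close> yields one of nearly the same
  quality in every much larger dimension \<open>M\<close>. Cut the coordinates into blocks of length \<open>n\<close> and
  cover each block by the given covering, scaled to the rounded mass of that block; there are
  few profiles of rounded masses. The factor lost in the number of centers is regained by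
  leaving one of \<open>k\<close> disjoint windows of coordinates uncovered, namely one that carries mass at
  most \<open>1 / k\<close>. This gives \<open>r\<^sub>M \<le> r\<^sub>n + 2 / k\<close>.

  For the bound, the integer vectors of \<open>l\<^sub>1\<close>-norm at most \<open>k = \<lfloor>c n\<rfloor>\<close> provide centers with
  \<open>r\<^sub>n \<le> n / (n + k)\<close>, and by Chernoff's bound there are at most \<open>2 ^ n\<close> of them when \<open>c = c3\<close>.
  So \<open>c2 = c3\<close> works.
\<close>

section \<open>Coverings with error measured by \<open>p\<close>-mass\<close>

definition lp_mass :: "real \<Rightarrow> 'i set \<Rightarrow> ('i \<Rightarrow> real) \<Rightarrow> real" where
  "lp_mass p I x = (\<Sum>i\<in>I. \<bar>x i\<bar> powr p)"

text \<open>\<open>r\<close> is the \<open>p\<close>-th power of the scaling factor, so that errors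
  on disjoint sets of coordinates simply add. The index type is arbitrary so that products of blocks
  and complements of windows can serve as index sets directly.\<close>

definition lp_cover :: "real \<Rightarrow> 'i set \<Rightarrow> nat \<Rightarrow> real \<Rightarrow> bool" where
  "lp_cover p I m r \<longleftrightarrow>
     (\<exists>U. finite U \<and> card U \<le> m \<and>
        (\<forall>x. lp_mass p I x \<le> 1 \<longrightarrow> (\<exists>u\<in>U. lp_mass p I (\<lambda>i. x i - u i) \<le> r)))"

lemma lp_mass_nonneg [simp]: "0 \<le> lp_mass p I x"
  by (simp add: lp_mass_def sum_nonneg)

lemma lp_mass_scale: "lp_mass p I (\<lambda>i. a * x i) = \<bar>a\<bar> powr p * lp_mass p I x"
  by (simp add: lp_mass_def abs_mult powr_mult sum_distrib_left)

lemma lp_mass_0 [simp]: "p > 0 \<Longrightarrow> lp_mass p I (\<lambda>_. 0) = 0"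
  by (simp add: lp_mass_def)

lemma lp_mass_cong: "(\<And>i. i \<in> I \<Longrightarrow> x i = y i) \<Longrightarrow> lp_mass p I x = lp_mass p I y"
  by (simp add: lp_mass_def cong: sum.cong)

lemma lp_mass_reindex: "bij_betw f J I \<Longrightarrow> lp_mass p J (\<lambda>j. x (f j)) = lp_mass p I x"
  unfolding lp_mass_def by (rule sum.reindex_bij_betw)

lemma lp_mass_split:
  assumes "finite I" "J \<subseteq> I"
  shows "lp_mass p I x = lp_mass p J x + lp_mass p (I - J) x"
  unfolding lp_mass_def using sum.subset_diff[OF assms(2,1)] by (simp add: add.commute)

lemma lp_mass_component_le_1:
  assumes "finite I" "i \<in> I" "p > 0" "lp_mass p I x \<le> 1"
  shows "\<bar>x i\<bar> \<le> 1"
proof -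
  have "\<bar>x i\<bar> powr p \<le> lp_mass p I x"
    unfolding lp_mass_def using assms by (intro member_le_sum) auto
  then have "\<bar>x i\<bar> powr p \<le> 1 powr p" using assms by simp
  moreover have "1 powr p < \<bar>x i\<bar> powr p" if "1 < \<bar>x i\<bar>"
    using that assms by (intro powr_less_mono2) auto
  ultimately show ?thesis by fastforce
qed

lemma lp_cover_mono:
  assumes "lp_cover p I m r" "m \<le> m'" "r \<le> r'"
  shows "lp_cover p I m' r'"
  using assms unfolding lp_cover_def by (meson order_trans)

lemma lp_cover_1:
  assumes "p > 0" "m \<ge> 1"
  shows "lp_cover p I m 1"
  unfolding lp_cover_def using assms by (intro exI[of _ "{\<lambda>_. 0}"]) auto

lemma lp_cover_bij:
  assumes f: "bij_betw f J I" and c: "lp_cover p I m r"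
  shows "lp_cover p J m r"
proof -
  obtain U where U: "finite U" "card U \<le> m"
    "\<And>x. lp_mass p I x \<le> 1 \<Longrightarrow> \<exists>u\<in>U. lp_mass p I (\<lambda>i. x i - u i) \<le> r"
    using c unfolding lp_cover_def by blast
  have "\<exists>v\<in>(\<lambda>u j. u (f j)) ` U. lp_mass p J (\<lambda>j. x j - v j) \<le> r" if x: "lp_mass p J x \<le> 1" for x
  proof -
    define y where "y = (\<lambda>i. x (inv_into J f i))"
    have y: "y (f j) = x j" if "j \<in> J" for j
      using f that by (simp add: y_def bij_betw_def inv_into_f_f)
    have "lp_mass p I y = lp_mass p J (\<lambda>j. y (f j))" by (rule lp_mass_reindex[OF f, symmetric])
    also have "\<dots> = lp_mass p J x" by (rule lp_mass_cong) (rule y)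
    finally have "lp_mass p I y \<le> 1" using x by simp
    then obtain u where u: "u \<in> U" "lp_mass p I (\<lambda>i. y i - u i) \<le> r" using U(3) by blast
    have "lp_mass p I (\<lambda>i. y i - u i) = lp_mass p J (\<lambda>j. y (f j) - u (f j))"
      using lp_mass_reindex[OF f, of p "\<lambda>i. y i - u i"] by simp
    also have "\<dots> = lp_mass p J (\<lambda>j. x j - u (f j))" by (rule lp_mass_cong) (simp add: y)
    finally show ?thesis using u by auto
  qed
  moreover have "card ((\<lambda>u j. u (f j)) ` U) \<le> m" using card_image_le[OF U(1)] U(2) by (rule order_trans)
  moreover have "finite ((\<lambda>u j. u (f j)) ` U)" using U(1) by simp
  ultimately show ?thesis unfolding lp_cover_def by blast
qed

text \<open>A vector of mass at most \<open>s\<close> is a point of the unit ball dilated by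
  \<open>s powr (1/p)\<close>, and this dilation multiplies errors by \<open>s\<close>. Each block
  of coordinates gets covered in this way at its own scale.\<close>

lemma lp_cover_scaled:
  assumes p: "p > 0" and "finite I" and s: "0 \<le> s" "lp_mass p I x \<le> s"
    and U: "\<And>x. lp_mass p I x \<le> 1 \<Longrightarrow> \<exists>u\<in>U. lp_mass p I (\<lambda>i. x i - u i) \<le> r"
  shows "\<exists>u\<in>U. lp_mass p I (\<lambda>i. x i - s powr (1/p) * u i) \<le> s * r"
proof (cases "s = 0")
  case True
  \<comment> \<open>This only shows that \<open>U\<close> is nonempty: the scaled centers vanish and
    \<open>x\<close> has mass 0, so any \<open>u\<close> will do.\<close>
  obtain u where "u \<in> U" using U[of "\<lambda>_. 0"] p by auto
  then show ?thesis using True s by auto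
next
  case False
  define a where "a = s powr (1/p)"
  have a: "a > 0" "\<bar>a\<bar> powr p = s" using False s p by (auto simp: a_def powr_powr)
  have "lp_mass p I (\<lambda>i. a * (x i / a)) = s * lp_mass p I (\<lambda>i. x i / a)"
    by (subst lp_mass_scale) (simp add: a)
  then have "s * lp_mass p I (\<lambda>i. x i / a) \<le> s * 1" using s a by simp
  then have "lp_mass p I (\<lambda>i. x i / a) \<le> 1" using s False by (simp add: mult_le_cancel_left)
  then obtain u where u: "u \<in> U" "lp_mass p I (\<lambda>i. x i / a - u i) \<le> r" using U by blast
  have "lp_mass p I (\<lambda>i. x i - a * u i) = lp_mass p I (\<lambda>i. a * (x i / a - u i))"
    by (rule lp_mass_cong) (use a in \<open>simp add: right_diff_distrib\<close>)
  also have "\<dots> = s * lp_mass p I (\<lambda>i. x i / a - u i)" by (subst lp_mass_scale) (simp add: a)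
  also have "\<dots> \<le> s * r" using u s by (intro mult_left_mono)
  finally show ?thesis using u a_def by blast
qed

section \<open>Counting lattice points\<close>

text \<open>Chernoff's bound: each counted \<open>t\<close> contributes at least \<open>s ^ T\<close> to the expansion of
  the product.\<close>

lemma card_weight_bounded_le:
  fixes w :: "'a \<Rightarrow> nat" and s C :: real
  assumes "finite I" "finite A" "0 < s" "s \<le> 1" "(\<Sum>a\<in>A. s ^ w a) \<le> C"
  shows "real (card {t \<in> PiE I (\<lambda>_. A). (\<Sum>i\<in>I. w (t i)) \<le> T}) * s ^ T \<le> C ^ card I"
proof -
  let ?P = "PiE I (\<lambda>_. A)" and ?S = "{t \<in> PiE I (\<lambda>_. A). (\<Sum>i\<in>I. w (t i)) \<le> T}"
  have "real (card ?S) * s ^ T = (\<Sum>t\<in>?S. s ^ T)" by simp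
  also have "\<dots> \<le> (\<Sum>t\<in>?S. s ^ (\<Sum>i\<in>I. w (t i)))"
    by (rule sum_mono) (use assms in \<open>auto intro: power_decreasing\<close>)
  also have "\<dots> \<le> (\<Sum>t\<in>?P. s ^ (\<Sum>i\<in>I. w (t i)))"
    by (rule sum_mono2) (use assms in \<open>auto intro: finite_PiE\<close>)
  also have "\<dots> = (\<Prod>i\<in>I. \<Sum>a\<in>A. s ^ w a)"
    using assms by (subst prod_sum_PiE) (auto simp: power_sum)
  also have "\<dots> \<le> C ^ card I"
    using assms by (simp, intro power_mono) (auto intro: sum_nonneg)
  finally show ?thesis .
qed

lemma geometric_sum_le:
  fixes s :: real
  assumes "0 \<le> s" "s < 1"
  shows "(\<Sum>j\<le>k. s ^ j) \<le> 1 / (1 - s)"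
proof -
  have "(\<Sum>j\<le>k. s ^ j) \<le> (\<Sum>j. s ^ j)"
    by (rule sum_le_suminf) (use assms in \<open>auto simp: summable_geometric\<close>)
  then show ?thesis using assms by (simp add: suminf_geometric)
qed

text \<open>Chernoff's bound at \<open>s = 1/2\<close>, where each geometric factor is at most 2. It
  counts the profiles of rounded block masses.\<close>

lemma card_nat_bounded_sum_le:
  assumes "finite B"
  shows "card {t \<in> PiE B (\<lambda>_. {..T}). (\<Sum>b\<in>B. t b) \<le> T} \<le> 2 ^ (T + card B)"
proof -
  let ?S = "{t \<in> PiE B (\<lambda>_. {..T}). (\<Sum>b\<in>B. t b) \<le> T}"
  have "real (card ?S) * (1/2) ^ T \<le> 2 ^ card B"
    using card_weight_bounded_le[of B "{..T}" "1/2" "\<lambda>j. j" 2 T] geometric_sum_le[of "1/2" T] assms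
    by simp
  then have "real (card ?S) \<le> real (2 ^ (T + card B))"
    by (simp add: power_add field_simps)
  then show ?thesis by (simp only: of_nat_le_iff)
qed

section \<open>Carrying a covering over to much larger dimensions\<close>

text \<open>Block masses are rounded up to multiples of \<open>1 / (q L)\<close>, so that only \<open>2 ^ (q (L + 2))\<close>
  mass profiles occur; this is negligible when the blocks are large.\<close>

lemma lp_cover_blocks:
  fixes J :: "'j set" and B :: "'b set"
  assumes p: "p > 0" and fin: "finite J" "finite B" and q: "card B = q" "q > 0" and L: "L > 0"
    and r: "r \<ge> 0" and c: "lp_cover p J m r"
  shows "lp_cover p (B \<times> J) (2 ^ (q * (L + 2)) * m ^ q) (r * (1 + 1 / L))"
proof -
  obtain U where U: "finite U" "card U \<le> m"
    "\<And>x. lp_mass p J x \<le> 1 \<Longrightarrow> \<exists>u\<in>U. lp_mass p J (\<lambda>i. x i - u i) \<le> r"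
    using c unfolding lp_cover_def by blast
  \<comment> \<open>In units of \<open>1 / (q * L)\<close> the total mass is at most
    \<open>q * L\<close>, and rounding up adds at most one unit per block.\<close>
  define T where "T = {t \<in> PiE B (\<lambda>_. {..q * (L + 1)}). (\<Sum>b\<in>B. t b) \<le> q * (L + 1)}"
  define g :: "('b \<Rightarrow> nat) \<times> ('b \<Rightarrow> 'j \<Rightarrow> real) \<Rightarrow> 'b \<times> 'j \<Rightarrow> real"
    where "g = (\<lambda>(t, v) (b, i). (real (t b) / (q * L)) powr (1/p) * v b i)"
  define V where "V = g ` (T \<times> PiE B (\<lambda>_. U))"
  have finT: "finite T"
    unfolding T_def by (rule finite_subset[OF _ finite_PiE[of B "\<lambda>_. {..q * (L + 1)}"]]) (use fin in auto)
  have finP: "finite (PiE B (\<lambda>_. U))" using fin U by (auto intro: finite_PiE)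
  have "card V \<le> card (T \<times> PiE B (\<lambda>_. U))"
    unfolding V_def using finT finP by (intro card_image_le) simp
  also have "\<dots> = card T * card U ^ q" using fin q by (simp add: card_cartesian_product card_PiE)
  also have "\<dots> \<le> 2 ^ (q * (L + 2)) * m ^ q"
  proof (intro mult_mono power_mono)
    show "card T \<le> 2 ^ (q * (L + 2))"
      using card_nat_bounded_sum_le[OF fin(2), of "q * (L + 1)"] q
      by (simp add: T_def algebra_simps)
  qed (use U in auto)
  finally have cardV: "card V \<le> 2 ^ (q * (L + 2)) * m ^ q" .
  have "\<exists>v\<in>V. lp_mass p (B \<times> J) (\<lambda>i. x i - v i) \<le> r * (1 + 1 / L)"
    if x: "lp_mass p (B \<times> J) x \<le> 1" for x
  proof -
    define R where "R = (\<lambda>b. lp_mass p J (\<lambda>i. x (b, i)))"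
    have split: "lp_mass p (B \<times> J) y = (\<Sum>b\<in>B. lp_mass p J (\<lambda>i. y (b, i)))" for y
      unfolding lp_mass_def by (simp add: sum.cartesian_product)
    have sumR: "(\<Sum>b\<in>B. R b) \<le> 1" using x split[of x] by (simp add: R_def)
    have R0: "R b \<ge> 0" for b by (simp add: R_def)
    define t where "t = restrict (\<lambda>b. nat \<lceil>R b * (q * L)\<rceil>) B"
    have t_eq: "t b = nat \<lceil>R b * (q * L)\<rceil>" if "b \<in> B" for b using that by (simp add: t_def)
    have t_ge: "R b * (q * L) \<le> t b" if "b \<in> B" for b
      using t_eq[OF that] real_nat_ceiling_ge by simp
    have t_le: "t b \<le> R b * (q * L) + 1" if "b \<in> B" for b
      using t_eq[OF that] R0[of b] by simp
    have "real (\<Sum>b\<in>B. t b) \<le> (\<Sum>b\<in>B. R b * (q * L) + 1)"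
      unfolding of_nat_sum by (rule sum_mono) (use t_le in auto)
    also have "\<dots> = (\<Sum>b\<in>B. R b) * (q * L) + q"
      using q by (simp add: sum.distrib sum_distrib_right)
    also have "\<dots> \<le> 1 * real (q * L) + real q"
      using sumR by (intro add_right_mono mult_right_mono) auto
    also have "\<dots> = real (q * (L + 1))" by (simp add: algebra_simps)
    finally have sumt: "(\<Sum>b\<in>B. t b) \<le> q * (L + 1)" by linarith
    have "t b \<le> q * (L + 1)" if "b \<in> B" for b
      using member_le_sum[OF that, of t] fin sumt by force
    then have tT: "t \<in> T" unfolding T_def using sumt by (auto simp: t_def)
    define s where "s = (\<lambda>b. real (t b) / (q * L))"
    have "\<exists>u\<in>U. lp_mass p J (\<lambda>i. x (b, i) - s b powr (1/p) * u i) \<le> s b * r" if "b \<in> B" for b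
    proof (rule lp_cover_scaled[OF p fin(1) _ _ U(3)])
      show "0 \<le> s b" by (simp add: s_def)
      show "lp_mass p J (\<lambda>i. x (b, i)) \<le> s b"
        using t_ge[OF that] q L by (simp add: s_def R_def field_simps)
    qed
    then obtain u where u: "\<And>b. b \<in> B \<Longrightarrow> u b \<in> U"
      "\<And>b. b \<in> B \<Longrightarrow> lp_mass p J (\<lambda>i. x (b, i) - s b powr (1/p) * u b i) \<le> s b * r"
      by metis
    have "g (t, restrict u B) \<in> V" unfolding V_def using tT u by auto
    moreover have "lp_mass p (B \<times> J) (\<lambda>i. x i - g (t, restrict u B) i) \<le> r * (1 + 1 / L)"
    proof -
      have "lp_mass p (B \<times> J) (\<lambda>i. x i - g (t, restrict u B) i)
          = (\<Sum>b\<in>B. lp_mass p J (\<lambda>i. x (b, i) - s b powr (1/p) * u b i))"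
        unfolding split by (rule sum.cong) (auto simp: g_def s_def)
      also have "\<dots> \<le> (\<Sum>b\<in>B. s b * r)" by (rule sum_mono) (use u in auto)
      \<comment> \<open>The errors add up to \<open>r\<close> times the total rounded mass, which is
        at most \<open>1 + 1 / L\<close>.\<close>
      also have "\<dots> = real (\<Sum>b\<in>B. t b) / (q * L) * r"
        by (simp add: s_def sum_distrib_right sum_divide_distrib)
      also have "\<dots> \<le> real (q * (L + 1)) / (q * L) * r"
        using sumt r by (intro mult_right_mono divide_right_mono) (auto simp only: of_nat_le_iff of_nat_0_le_iff)
      also have "\<dots> = r * (1 + 1 / L)" using q L by (simp add: field_simps)
      finally show ?thesis .
    qed
    ultimately show ?thesis by blast
  qed
  moreover have "finite V" unfolding V_def using finT finP by simp
  ultimately show ?thesis unfolding lp_cover_def using cardV by blast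
qed

text \<open>Pigeonhole: among \<open>k\<close> disjoint windows of length \<open>D\<close>, one
  carries mass at most \<open>1 / k\<close>, and centers that are 0 there lose only that mass. As
  the window depends on the point, coverings for all \<open>k\<close> complements are united, which
  costs the factor \<open>k\<close>.\<close>

lemma lp_cover_drop_window:
  assumes p: "p > 0" and k: "k > 0" and kD: "k * D \<le> M"
    and c: "\<And>J. J \<subseteq> {..<M} \<Longrightarrow> card J = M - D \<Longrightarrow> lp_cover p J m r"
  shows "lp_cover p {..<M} (k * m) (r + 1 / k)"
proof -
  define W where "W = (\<lambda>j. {j * D..<(j + 1) * D})"
  have Wsub: "W j \<subseteq> {..<M}" if "j < k" for j
  proof -
    have "(j + 1) * D \<le> k * D" using that by (intro mult_right_mono) auto
    then show ?thesis using kD by (auto simp: W_def)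
  qed
  have "\<exists>U. finite U \<and> card U \<le> m \<and> (\<forall>x. lp_mass p ({..<M} - W j) x \<le> 1 \<longrightarrow>
      (\<exists>u\<in>U. lp_mass p ({..<M} - W j) (\<lambda>i. x i - u i) \<le> r))" if "j < k" for j
  proof -
    have "card ({..<M} - W j) = M - D"
      using Wsub[OF that] by (subst card_Diff_subset) (auto simp: W_def)
    then show ?thesis using c[of "{..<M} - W j"] unfolding lp_cover_def by blast
  qed
  then obtain U where U: "\<And>j. j < k \<Longrightarrow> finite (U j)" "\<And>j. j < k \<Longrightarrow> card (U j) \<le> m"
    "\<And>j x. j < k \<Longrightarrow> lp_mass p ({..<M} - W j) x \<le> 1 \<Longrightarrow>
        \<exists>u\<in>U j. lp_mass p ({..<M} - W j) (\<lambda>i. x i - u i) \<le> r"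
    by metis
  define h where "h = (\<lambda>j (u :: nat \<Rightarrow> real) i. if i \<in> W j then 0 else u i)"
  define V where "V = (\<Union>j<k. h j ` U j)"
  have "card V \<le> (\<Sum>j<k. card (h j ` U j))" unfolding V_def by (rule card_UN_le) simp
  also have "\<dots> \<le> (\<Sum>j<k. m)"
    by (rule sum_mono) (meson U(1,2) card_image_le lessThan_iff order_trans)
  finally have cardV: "card V \<le> k * m" by simp
  have "\<exists>v\<in>V. lp_mass p {..<M} (\<lambda>i. x i - v i) \<le> r + 1 / k"
    if x: "lp_mass p {..<M} x \<le> 1" for x
  proof -
    have "\<exists>j<k. lp_mass p (W j) x \<le> 1 / k"
    proof (rule ccontr)
      assume "\<not> ?thesis"
      then have "(\<Sum>j<k. 1 / k) < (\<Sum>j<k. lp_mass p (W j) x)"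
        using k by (intro sum_strict_mono) (auto simp: not_le)
      also have "\<dots> = lp_mass p (\<Union>j<k. W j) x"
      proof -
        have "disjnt (W i) (W j)" if "i < j" for i j
        proof -
          have "(i + 1) * D \<le> j * D" using that by (intro mult_right_mono) auto
          then show ?thesis by (auto simp: W_def disjnt_def)
        qed
        then have "W i \<inter> W j = {}" if "i \<noteq> j" for i j
          using that by (metis disjnt_def disjnt_sym linorder_neqE_nat)
        then show ?thesis unfolding lp_mass_def
          by (subst sum.UNION_disjoint) (auto simp: W_def)
      qed
      also have "\<dots> \<le> lp_mass p {..<M} x"
        unfolding lp_mass_def using Wsub by (intro sum_mono2) auto
      finally show False using x k by simp
    qed
    then obtain j where j: "j < k" "lp_mass p (W j) x \<le> 1 / k" by blast
    note split = lp_mass_split[OF _ Wsub[OF j(1)], of p]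
    have "lp_mass p ({..<M} - W j) x \<le> 1"
      using x split[of x, OF finite_lessThan] lp_mass_nonneg[of p "W j" x] by linarith
    then obtain u where u: "u \<in> U j" "lp_mass p ({..<M} - W j) (\<lambda>i. x i - u i) \<le> r"
      using U(3) j by blast
    have "lp_mass p {..<M} (\<lambda>i. x i - h j u i)
        = lp_mass p (W j) x + lp_mass p ({..<M} - W j) (\<lambda>i. x i - u i)"
      using split[of "\<lambda>i. x i - h j u i", OF finite_lessThan]
        lp_mass_cong[of "W j" "\<lambda>i. x i - h j u i" x p]
        lp_mass_cong[of "{..<M} - W j" "\<lambda>i. x i - h j u i" "\<lambda>i. x i - u i" p]
      by (simp add: h_def)
    then have "lp_mass p {..<M} (\<lambda>i. x i - h j u i) \<le> r + 1 / k" using u j by simp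
    then show ?thesis using u j V_def by blast
  qed
  moreover have "finite V" unfolding V_def using U(1) by auto
  ultimately show ?thesis unfolding lp_cover_def using cardV by blast
qed

text \<open>With \<open>M = q * n + D\<close>, a window of \<open>D\<close> coordinates is dropped
  and the other \<open>q * n\<close> are cut into \<open>q\<close> blocks. The spare factor
  \<open>2 ^ D\<close> has to pay for the mass profiles and for the choice among \<open>k\<close>
  windows, while \<open>k\<close> windows of length \<open>D\<close> must still fit into
  \<open>M\<close> coordinates.\<close>

lemma lp_cover_extend:
  fixes k n M :: nat
  assumes p: "p > 0" and k: "k > 0" and n: "2 * k * (k + 3) \<le> n" and M: "4 * k * (n + k + 3) \<le> M"
    and r: "0 \<le> r" "r \<le> 1" and c: "lp_cover p {..<n} (2 ^ n) r"
  shows "lp_cover p {..<M} (2 ^ M) (r + 2 / k)"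
proof -
  \<comment> \<open>Each block reserves \<open>k + 3\<close> spare coordinates: \<open>k + 2\<close>
    pay for the mass profiles (with \<open>L = k\<close>), and the last ones,
    \<open>q \<ge> k\<close> in total, pay for the \<open>k\<close> windows because
    \<open>k \<le> 2 ^ k\<close>.\<close>
  define q where "q = M div (n + k + 3)"
  have qM: "q * (n + k + 3) \<le> M" unfolding q_def by (rule div_times_less_eq_dividend)
  have Mq: "M < q * (n + k + 3) + (n + k + 3)"
    unfolding q_def using dividend_less_div_times[of "n + k + 3" M] by simp
  have q4: "4 * k \<le> q" unfolding q_def using M by (simp add: less_eq_div_iff_mult_less_eq)
  then have q0: "q > 0" using k by simp
  define D where "D = M - q * n"
  have MD: "M = q * n + D" using qM by (simp add: D_def algebra_simps)
  have D_ge: "q * (k + 2) + k \<le> D"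
    using qM q4 unfolding MD by (simp add: algebra_simps)
  have D_le: "D \<le> q * (k + 3) + (n + k + 3)" using Mq unfolding MD by (simp add: algebra_simps)
  \<comment> \<open>By \<open>D_le\<close>, \<open>2 * (k * D)\<close> is at most the sum of
    \<open>q * (2 * k * (k + 3))\<close>, controlled by the size of \<open>n\<close>, and
    \<open>2 * k * (n + (k + 3))\<close>, controlled by \<open>k + 3 \<le> n\<close> and
    \<open>4 * k \<le> q\<close>. Each is at most \<open>q * n\<close>.\<close>
  have "k * D \<le> M"
  proof -
    have "k + 3 \<le> 1 * 2 * k * (k + 3)" using k by simp
    then have n2: "k + 3 \<le> n" using n by linarith
    have "2 * (k * D) \<le> 2 * k * (q * (k + 3) + (n + k + 3))" using D_le by simp
    also have "\<dots> = q * (2 * k * (k + 3)) + 2 * k * (n + (k + 3))" by (simp add: algebra_simps)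
    also have "\<dots> \<le> q * n + 2 * k * (n + n)"
      using n n2 by (intro add_mono mult_left_mono) auto
    also have "\<dots> = q * n + (4 * k) * n" by simp
    also have "\<dots> \<le> q * n + q * n" using q4 by (intro add_mono mult_right_mono) auto
    finally show ?thesis using MD by linarith
  qed
  have "lp_cover p {..<M} (k * (2 ^ (q * (k + 2)) * (2 ^ n) ^ q)) (r * (1 + 1 / k) + 1 / k)"
  proof (rule lp_cover_drop_window[OF p k \<open>k * D \<le> M\<close>])
    fix J assume J: "J \<subseteq> {..<M}" "card J = M - D"
    have "card J = card ({..<q} \<times> {..<n})" using J MD by simp
    then obtain f where "bij_betw f J ({..<q} \<times> {..<n})"
      using J finite_same_card_bij[of J "{..<q} \<times> {..<n}"] finite_subset by blast
    then show "lp_cover p J (2 ^ (q * (k + 2)) * (2 ^ n) ^ q) (r * (1 + 1 / k))"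
      by (rule lp_cover_bij) (use lp_cover_blocks[OF p _ _ _ q0 k r(1) c, of "{..<q}"] in simp)
  qed
  then show ?thesis
  proof (rule lp_cover_mono)
    have "k * (2 ^ (q * (k + 2)) * (2 ^ n) ^ q) \<le> 2 ^ k * (2 ^ (q * (k + 2)) * (2 ^ n) ^ q)"
      by (intro mult_right_mono) (auto intro: less_imp_le less_exp)
    also have "\<dots> = 2 ^ (k + (q * (k + 2) + n * q))" by (simp only: power_add power_mult)
    also have "\<dots> \<le> 2 ^ M" using D_ge MD by (intro power_increasing) (auto simp: algebra_simps)
    finally show "k * (2 ^ (q * (k + 2)) * (2 ^ n) ^ q) \<le> 2 ^ M" .
    \<comment> \<open>One \<open>1 / k\<close> is the rounding loss, since \<open>r \<le> 1\<close>;
      the other is the mass of the dropped window.\<close>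
    show "r * (1 + 1 / k) + 1 / k \<le> r + 2 / k"
      using r k by (simp add: field_simps)
  qed
qed

section \<open>The explicit covering by lattice centers\<close>

text \<open>Greedy choice: the new index takes \<open>min k (f a)\<close> and the rest is left to
  the induction, hence the generalization over \<open>k\<close>. It serves to lower a rounded vector
  to total exactly \<open>k\<close>.\<close>

lemma ex_nat_fun_sum_eq:
  fixes f :: "'a \<Rightarrow> nat"
  assumes "finite I" "k \<le> (\<Sum>i\<in>I. f i)"
  shows "\<exists>g. (\<forall>i. g i \<le> f i) \<and> (\<Sum>i\<in>I. g i) = k"
  using assms
proof (induction I arbitrary: k)
  case empty
  then show ?case by (intro exI[of _ f]) auto
next
  case (insert a I)
  have "k - min k (f a) \<le> (\<Sum>i\<in>I. f i)" using insert.prems unfolding sum.insert[OF insert.hyps] by linarith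
  from insert.IH[OF this]
  obtain g where g: "\<forall>i. g i \<le> f i" "(\<Sum>i\<in>I. g i) = k - min k (f a)" by blast
  show ?case
  proof (intro exI conjI)
    show "\<forall>i. (g(a := min k (f a))) i \<le> f i" using g by simp
    have I: "(\<Sum>i\<in>I. (g(a := min k (f a))) i) = (\<Sum>i\<in>I. g i)"
      using insert.hyps by (intro sum.cong) auto
    show "(\<Sum>i\<in>insert a I. (g(a := min k (f a))) i) = k"
      unfolding sum.insert[OF insert.hyps] I g(2) fun_upd_same by linarith
  qed
qed

text \<open>Split off one factor from each power; the remaining exponent \<open>p - 1\<close> is
  nonnegative, so both bases may be enlarged to \<open>a + b\<close>.\<close>

lemma powr_superadditive:
  fixes a b p :: real
  assumes "0 \<le> a" "0 \<le> b" "1 \<le> p"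
  shows "a powr p + b powr p \<le> (a + b) powr p"
proof -
  have mult: "c powr p = c * c powr (p - 1)" if "0 \<le> c" for c :: real
    using that by (cases "c = 0") (simp_all add: powr_diff)
  have "a powr p + b powr p \<le> a * (a + b) powr (p - 1) + b * (a + b) powr (p - 1)"
    using assms mult by (intro add_mono) (auto intro!: mult_left_mono powr_mono2)
  also have "\<dots> = (a + b) powr p" using assms mult[of "a + b"] by (simp add: algebra_simps)
  finally show ?thesis .
qed

text \<open>The centers have \<open>p\<close>-th powers of coordinates in the integers, up to scale; a point is
  sent to a center obtained by rounding its \<open>p\<close>-th powers towards 0, and rounding further
  if their sum is still larger than \<open>k\<close>.\<close>

lemma lp_cover_lattice:
  fixes n k :: nat and I :: "'i set"
  assumes p: "1 \<le> p" and n: "finite I" "card I = n" "n > 0"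
    and m: "card {t \<in> PiE I (\<lambda>_. {- int k..int k}). (\<Sum>i\<in>I. nat \<bar>t i\<bar>) \<le> k} \<le> m"
  shows "lp_cover p I m (real n / real (n + k))"
proof -
  define T where "T = {t \<in> PiE I (\<lambda>_. {- int k..int k}). (\<Sum>i\<in>I. nat \<bar>t i\<bar>) \<le> k}"
  \<comment> \<open>With this scale the rescaled \<open>p\<close>-th powers \<open>a i\<close> sum
    to at most \<open>n + k\<close>.\<close>
  define R where "R = real (n + k)"
  have R0: "R > 0" using n by (simp add: R_def)
  define g :: "('i \<Rightarrow> int) \<Rightarrow> 'i \<Rightarrow> real"
    where "g = (\<lambda>t i. sgn (real_of_int (t i)) * (\<bar>real_of_int (t i)\<bar> / R) powr (1/p))"
  have finT: "finite T"
    unfolding T_def by (rule finite_subset[OF _ finite_PiE[of I "\<lambda>_. {- int k..int k}"]]) (use n in auto)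
  have "\<exists>v\<in>g ` T. lp_mass p I (\<lambda>i. x i - v i) \<le> n / (n + k)" if x: "lp_mass p I x \<le> 1" for x
  proof -
    define a where "a = (\<lambda>i. R * \<bar>x i\<bar> powr p)"
    define f where "f = (\<lambda>i. nat \<lfloor>a i\<rfloor>)"
    have a0: "0 \<le> a i" for i using R0 by (simp add: a_def)
    have fa: "real (f i) \<le> a i" "a i \<le> real (f i) + 1" for i
      unfolding f_def using a0[of i] by linarith+
    have suma: "(\<Sum>i\<in>I. a i) \<le> n + k"
    proof -
      have "(\<Sum>i\<in>I. a i) = R * lp_mass p I x" by (simp add: a_def lp_mass_def sum_distrib_left)
      also have "\<dots> \<le> R * 1" using x R0 by (intro mult_left_mono) auto
      finally show ?thesis by (simp add: R_def)
    qed
    \<comment> \<open>The loss is at most \<open>n\<close> either way. If the integer parts total at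
      most \<open>k\<close>, each of the \<open>n\<close> coordinates loses at most 1; otherwise
      they are lowered to total exactly \<open>k\<close>, and at most \<open>n + k - k\<close>
      remains.\<close>
    have "\<exists>z. (\<forall>i. real (z i) \<le> a i) \<and> (\<Sum>i\<in>I. z i) \<le> k \<and> (\<Sum>i\<in>I. a i - real (z i)) \<le> n"
    proof (cases "(\<Sum>i\<in>I. f i) \<le> k")
      case True
      have "(\<Sum>i\<in>I. a i - real (f i)) \<le> (\<Sum>i\<in>I. 1)"
        by (rule sum_mono) (use fa in \<open>simp add: algebra_simps\<close>)
      then show ?thesis using True fa n by (intro exI[of _ f]) auto
    next
      case False
      then obtain z where z: "\<forall>i. z i \<le> f i" "(\<Sum>i\<in>I. z i) = k"
        using ex_nat_fun_sum_eq[of I k f] n by auto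
      have "real (z i) \<le> a i" for i using z fa(1)[of i] by (meson of_nat_mono order_trans)
      moreover have "(\<Sum>i\<in>I. a i - real (z i)) \<le> n"
        using suma z(2) by (simp add: sum_subtractf flip: of_nat_sum)
      ultimately show ?thesis using z by (intro exI[of _ z]) auto
    qed
    then obtain z where z: "\<And>i. real (z i) \<le> a i" "(\<Sum>i\<in>I. z i) \<le> k"
      "(\<Sum>i\<in>I. a i - real (z i)) \<le> n" by blast
    define t where "t = restrict (\<lambda>i. if x i < 0 then - int (z i) else int (z i)) I"
    have abs_t: "\<bar>t i\<bar> = int (z i)" if "i \<in> I" for i using that by (simp add: t_def)
    have zk: "z i \<le> k" if "i \<in> I" for i
      using member_le_sum[OF that, of z] z(2) n by force
    have "(\<Sum>i\<in>I. nat \<bar>t i\<bar>) = (\<Sum>i\<in>I. z i)" by (rule sum.cong) (auto simp: abs_t)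
    then have tT: "t \<in> T" unfolding T_def using z zk by (auto simp: t_def)
    have main: "\<bar>x i - g t i\<bar> powr p \<le> (a i - z i) / R" if i: "i \<in> I" for i
    proof -
      define y where "y = (z i / R) powr (1/p)"
      have y0: "0 \<le> y" by (simp add: y_def)
      have yp: "y powr p = z i / R" using p R0 by (simp add: y_def powr_powr)
      have xp: "\<bar>x i\<bar> powr p = a i / R" using R0 by (simp add: a_def)
      have "y \<le> \<bar>x i\<bar>"
      proof -
        have "y \<le> (\<bar>x i\<bar> powr p) powr (1/p)"
          unfolding y_def xp using z(1)[of i] R0 p by (intro powr_mono2) (auto simp: divide_right_mono)
        then show ?thesis using p by (simp add: powr_powr)
      qed
      \<comment> \<open>For \<open>z i = 0\<close> both sides are 0, so \<open>sgn 0 = 0\<close>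
        does no harm.\<close>
      have "g t i = (if x i < 0 then - y else y)"
        using i p by (auto simp: g_def t_def y_def sgn_if)
      then have "\<bar>x i - g t i\<bar> = \<bar>x i\<bar> - y"
        using \<open>y \<le> \<bar>x i\<bar>\<close> y0 by auto
      \<comment> \<open>Superadditivity turns a difference of absolute values into a difference of
        \<open>p\<close>-th powers, which is what the rounding controls.\<close>
      moreover have "(\<bar>x i\<bar> - y) powr p + y powr p \<le> \<bar>x i\<bar> powr p"
        using powr_superadditive[of "\<bar>x i\<bar> - y" y p] \<open>y \<le> \<bar>x i\<bar>\<close> y0 p by simp
      ultimately show ?thesis using xp yp by (simp add: diff_divide_distrib)
    qed
    have "lp_mass p I (\<lambda>i. x i - g t i) \<le> (\<Sum>i\<in>I. (a i - z i) / R)"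
      unfolding lp_mass_def by (rule sum_mono) (use main in auto)
    also have "\<dots> = (\<Sum>i\<in>I. a i - z i) / R" by (simp add: sum_divide_distrib)
    also have "\<dots> \<le> n / R" using z(3) R0 by (simp add: divide_right_mono)
    finally show ?thesis using tT by (auto simp: R_def)
  qed
  moreover have "card (g ` T) \<le> m" using card_image_le[OF finT, of g] m by (simp add: T_def)
  ultimately show ?thesis unfolding lp_cover_def using finT by blast
qed

text \<open>The logarithm of Chernoff's bound with weight \<open>nat \<bar>a\<bar>\<close>. For
  \<open>c = c3\<close> the right-hand side becomes \<open>card I * ln 2\<close>.\<close>

lemma card_int_bounded_l1_le:
  fixes c :: real
  assumes "finite I" "0 < c" "k \<le> c * card I"
  shows "ln (card {t \<in> PiE I (\<lambda>_. {- int k..int k}). (\<Sum>i\<in>I. nat \<bar>t i\<bar>) \<le> k})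
     \<le> card I * (c * ln 2 + (1 + c) * ln (1 + c) - c * ln c)" (is "ln (card ?S) \<le> _")
proof -
  define n where "n = card I"
  \<comment> \<open>half of the optimal Chernoff parameter \<open>c / (1 + c)\<close> for non-negative vectors; the factor
    2 pays for the signs\<close>
  define s where "s = c / (2 * (1 + c))"
  have s: "0 < s" "2 * s < 1" "1 / (1 - 2 * s) = 1 + c"
    using assms by (auto simp: s_def field_simps)
  \<comment> \<open>Separating the signs gives two geometric sums, of which only one contains the
    term for 0.\<close>
  have "{- int k..int k} = {0..int k} \<union> {- int k..-1}" by auto
  then have "(\<Sum>a\<in>{- int k..int k}. s ^ nat \<bar>a\<bar>)
      = (\<Sum>a\<in>{0..int k}. s ^ nat \<bar>a\<bar>) + (\<Sum>a\<in>{- int k..-1}. s ^ nat \<bar>a\<bar>)"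
    by (simp add: sum.union_disjoint)
  also have "(\<Sum>a\<in>{0..int k}. s ^ nat \<bar>a\<bar>) = (\<Sum>j\<le>k. s ^ j)"
    by (rule sum.reindex_bij_witness[of _ int nat]) auto
  also have "(\<Sum>a\<in>{- int k..-1}. s ^ nat \<bar>a\<bar>) = (\<Sum>j\<in>{..k} - {0}. s ^ j)"
    by (rule sum.reindex_bij_witness[of _ "\<lambda>j. - int j" "\<lambda>a. nat (- a)"]) auto
  also have "\<dots> = (\<Sum>j\<le>k. s ^ j) - 1" by (simp add: sum_diff1)
  also have "(\<Sum>j\<le>k. s ^ j) + ((\<Sum>j\<le>k. s ^ j) - 1) \<le> 1 / (1 - s) + (1 / (1 - s) - 1)"
    using geometric_sum_le[of s k] s by simp
  \<comment> \<open>The left-hand side is \<open>(1 + s) / (1 - s)\<close>, and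
    \<open>(1 + s) * (1 - 2 * s) = 1 - s - 2 * s * s\<close>.\<close>
  also have "\<dots> \<le> 1 / (1 - 2 * s)"
    using s by (simp add: field_simps)
  finally have "(\<Sum>a\<in>{- int k..int k}. s ^ nat \<bar>a\<bar>) \<le> 1 + c" by (simp only: s)
  then have le: "real (card ?S) * s ^ k \<le> (1 + c) ^ n"
    unfolding n_def using s assms by (intro card_weight_bounded_le) auto
  \<comment> \<open>The zero vector makes the count positive, so that logarithms may be
    taken.\<close>
  have "(\<lambda>i\<in>I. 0) \<in> ?S" by auto
  moreover have "finite ?S"
    by (rule finite_subset[OF _ finite_PiE[of I "\<lambda>_. {- int k..int k}"]]) (use assms in auto)
  ultimately have pos: "card ?S > 0" by (metis (no_types, lifting) card_gt_0_iff empty_iff)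
  have "ln (real (card ?S) * s ^ k) \<le> ln ((1 + c) ^ n)"
    using le pos s assms by (subst ln_le_cancel_iff) auto
  then have "ln (card ?S) + k * ln s \<le> n * ln (1 + c)"
    using pos s assms by (simp add: ln_mult_pos ln_realpow)
  moreover have "k * (- ln s) \<le> (c * n) * (- ln s)"
    using s assms by (intro mult_right_mono) (auto simp: n_def)
  moreover have "ln (2 * (1 + c)) = ln 2 + ln (1 + c)"
    using assms by (intro ln_mult_pos) auto
  then have "ln s = ln c - ln 2 - ln (1 + c)"
    unfolding s_def using assms by (subst ln_divide_pos) auto
  ultimately show ?thesis by (simp add: n_def algebra_simps)
qed

lemma nat_le_power_if_ln_le:
  assumes "ln (real N) \<le> ln (2 ^ n)"
  shows "N \<le> 2 ^ n"
proof (cases "N = 0")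
  case False
  then have "real N \<le> 2 ^ n" using assms by (subst (asm) ln_le_cancel_iff) auto
  then show ?thesis by simp
qed simp

text \<open>The equation defining \<open>c3\<close>, in logarithmic form, says that the bound on the
  number of lattice centers is exactly \<open>2 ^ n\<close>.\<close>

lemma lp_cover_c3:
  assumes p: "1 \<le> p" and n: "n > 0"
  shows "lp_cover p {..<n} (2 ^ n) (real n / real (n + nat \<lfloor>c3 * real n\<rfloor>))"
proof (rule lp_cover_lattice[OF p])
  define k where "k = nat \<lfloor>c3 * n\<rfloor>"
  let ?S = "{t \<in> PiE {..<n} (\<lambda>_. {- int k..int k}). (\<Sum>i<n. nat \<bar>t i\<bar>) \<le> k}"
  have "real k \<le> c3 * n" using c3_props(1) by (simp add: k_def)
  then have "ln (card ?S) \<le> n * (c3 * ln 2 + (1 + c3) * ln (1 + c3) - c3 * ln c3)"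
    using card_int_bounded_l1_le[of "{..<n}" c3 k] c3_props(1) by simp
  also have "c3 * ln 2 + (1 + c3) * ln (1 + c3) - c3 * ln c3 = ln 2"
    using c3_eq_iff[OF c3_props(1)] c3_props(2) by (simp add: algebra_simps)
  finally have "ln (card ?S) \<le> ln (2 ^ n)" by (simp add: ln_realpow)
  then show "card ?S \<le> 2 ^ n" by (rule nat_le_power_if_ln_le)
qed (use n in auto)

section \<open>Attainment of the minimum\<close>

text \<open>Clamping the centers to the unit cube keeps a covering, so centers range over a compact
  set.\<close>

lemma lp_cover_iff_indexed:
  assumes p: "p > 0" and I: "finite I" and m: "m > 0"
  shows "lp_cover p I m r \<longleftrightarrow> (\<exists>u. (\<forall>j i. \<bar>u (j, i)\<bar> \<le> 1) \<and>
     (\<forall>x. lp_mass p I x \<le> 1 \<longrightarrow> (\<exists>j<m. lp_mass p I (\<lambda>i. x i - u (j, i)) \<le> r)))"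
    (is "_ \<longleftrightarrow> ?R")
proof
  assume "lp_cover p I m r"
  then obtain U where U: "finite U" "card U \<le> m"
    "\<And>x. lp_mass p I x \<le> 1 \<Longrightarrow> \<exists>u\<in>U. lp_mass p I (\<lambda>i. x i - u i) \<le> r"
    unfolding lp_cover_def by blast
  obtain e where e: "bij_betw e {..<card U} U"
    using ex_bij_betw_nat_finite[OF U(1)] by (auto simp: atLeast0LessThan)
  \<comment> \<open>Indices from \<open>card U\<close> on get arbitrary clamped values; additional
    centers do no harm.\<close>
  define u where "u = (\<lambda>(j, i). max (- 1) (min 1 (e j i)))"
  have "\<exists>j<m. lp_mass p I (\<lambda>i. x i - u (j, i)) \<le> r" if x: "lp_mass p I x \<le> 1" for x
  proof -
    obtain v where v: "v \<in> U" "lp_mass p I (\<lambda>i. x i - v i) \<le> r" using U(3) x by blast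
    then have "v \<in> e ` {..<card U}" using e by (simp add: bij_betw_def)
    then obtain j where j: "j < card U" "e j = v" by blast
    have "lp_mass p I (\<lambda>i. x i - u (j, i)) \<le> lp_mass p I (\<lambda>i. x i - v i)"
      unfolding lp_mass_def
    proof (rule sum_mono)
      fix i assume "i \<in> I"
      then have "\<bar>x i\<bar> \<le> 1" using lp_mass_component_le_1[OF I] p x by blast
      \<comment> \<open>Projecting onto \<open>[-1, 1]\<close> brings a number no farther from any
        point of that interval.\<close>
      then have "\<bar>x i - u (j, i)\<bar> \<le> \<bar>x i - v i\<bar>" using j by (auto simp: u_def)
      then show "\<bar>x i - u (j, i)\<bar> powr p \<le> \<bar>x i - v i\<bar> powr p"
        using p by (intro powr_mono2) auto
    qed
    then show ?thesis using v j U(2) by (intro exI[of _ j]) auto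
  qed
  then show ?R by (intro exI[of _ u]) (auto simp: u_def)
next
  assume ?R
  then obtain u where u: "\<And>x. lp_mass p I x \<le> 1 \<Longrightarrow> \<exists>j<m. lp_mass p I (\<lambda>i. x i - u (j, i)) \<le> r"
    by blast
  have "card ((\<lambda>j i. u (j, i)) ` {..<m}) \<le> m" using card_image_le[of "{..<m}"] by simp
  then show "lp_cover p I m r" unfolding lp_cover_def
    using u by (intro exI[of _ "(\<lambda>j i. u (j, i)) ` {..<m}"]) auto
qed

text \<open>Pairs of an error in \<open>[0, 1]\<close> and a family of clamped centers form a
  compact set by Tychonoff's theorem. Being a covering is a closed condition, as an intersection
  over all points of finite unions of closed sets, so the error attains its minimum.\<close>

lemma lp_cover_minimum:
  fixes I :: "'i set"
  assumes p: "p > 0" and I: "finite I" and m: "m > 0"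
  shows "\<exists>r. 0 \<le> r \<and> r \<le> 1 \<and> lp_cover p I m r \<and> (\<forall>r'\<ge>0. lp_cover p I m r' \<longrightarrow> r \<le> r')"
proof -
  \<comment> \<open>Uncurried families make this a single product of intervals.\<close>
  define B :: "(nat \<times> 'i \<Rightarrow> real) set" where "B = PiE UNIV (\<lambda>_. {-1..1})"
  define F where "F = (\<lambda>x j. {z :: real \<times> (nat \<times> 'i \<Rightarrow> real).
      lp_mass p I (\<lambda>i. x i - snd z (j, i)) \<le> fst z})"
  define S where "S = ({0..1} \<times> B) \<inter> (\<Inter>x\<in>{x. lp_mass p I x \<le> 1}. \<Union>j<m. F x j)"
  have "compactin (product_topology (\<lambda>_. euclidean) UNIV) B"
    unfolding B_def compactin_PiE by auto
  then have "compact B" by (simp add: euclidean_product_topology)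
  moreover have "closed (F x j)" for x j
    unfolding F_def lp_mass_def
  proof (intro closed_Collect_le continuous_on_sum continuous_on_fst continuous_on_id)
    fix i assume "i \<in> I"
    have "continuous_on UNIV (\<lambda>z :: real \<times> (nat \<times> 'i \<Rightarrow> real). snd z (j, i))"
      by (rule continuous_on_compose2[OF continuous_on_product_coordinates continuous_on_snd])
        (auto intro: continuous_on_id)
    then have "continuous_on UNIV (\<lambda>z :: real \<times> (nat \<times> 'i \<Rightarrow> real). \<bar>x i - snd z (j, i)\<bar>)"
      by (intro continuous_intros)
    then show "continuous_on UNIV (\<lambda>z :: real \<times> (nat \<times> 'i \<Rightarrow> real). \<bar>x i - snd z (j, i)\<bar> powr p)"
      using p by (intro continuous_on_powr' continuous_on_const) auto
  qed
  ultimately have "compact S" unfolding S_def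
    by (intro compact_Int_closed compact_Times closed_INT) auto
  have B_iff: "u \<in> B \<longleftrightarrow> (\<forall>j i. \<bar>u (j, i)\<bar> \<le> 1)" for u
    by (simp add: B_def PiE_UNIV_domain Pi_def abs_le_iff minus_le_iff conj_commute)
  have S_iff: "lp_cover p I m r \<longleftrightarrow> (\<exists>u. (r, u) \<in> S)" if "0 \<le> r" "r \<le> 1" for r
    using that by (simp add: lp_cover_iff_indexed[OF p I m] S_def F_def B_iff Bex_def)
  have "\<exists>u. (1, u) \<in> S" using lp_cover_1[OF p, of m I] m S_iff[of 1] by simp
  then have "S \<noteq> {}" by blast
  moreover have "continuous_on S fst" by (intro continuous_on_fst continuous_on_id)
  ultimately have "\<exists>z\<in>S. \<forall>z'\<in>S. fst z \<le> fst z'" by (rule continuous_attains_inf[OF \<open>compact S\<close>])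
  then obtain z where z: "z \<in> S" "\<And>z'. z' \<in> S \<Longrightarrow> fst z \<le> fst z'" by blast
  have z01: "0 \<le> fst z" "fst z \<le> 1" using z(1) by (auto simp: S_def)
  moreover have "lp_cover p I m (fst z)"
    unfolding S_iff[OF z01] using z(1) by (intro exI[of _ "snd z"]) simp
  moreover have "fst z \<le> r'" if r': "0 \<le> r'" "lp_cover p I m r'" for r'
  proof (cases "r' \<le> 1")
    case True
    then obtain u where "(r', u) \<in> S" using r' S_iff[of r'] by blast
    then show ?thesis using z(2)[of "(r', u)"] by simp
  qed (use z01 in simp)
  ultimately show ?thesis by blast
qed

text \<open>With error 0 every point agrees on \<open>I\<close> with a center, so the finitely many
  centers would exhaust a segment on a coordinate axis. Hence the minimal error is positive, as the
  definition of the covering functional demands of the factor.\<close>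

lemma not_lp_cover_0:
  assumes p: "p > 0" and "finite I" "I \<noteq> {}"
  shows "\<not> lp_cover p I m 0"
proof
  assume "lp_cover p I m 0"
  then obtain U where U: "finite U"
    "\<And>x. lp_mass p I x \<le> 1 \<Longrightarrow> \<exists>u\<in>U. lp_mass p I (\<lambda>i. x i - u i) \<le> 0"
    unfolding lp_cover_def by blast
  obtain a where a: "a \<in> I" using assms by blast
  have "{0..1::real} \<subseteq> (\<lambda>u. u a) ` U"
  proof
    fix y :: real assume y: "y \<in> {0..1}"
    have "lp_mass p I (\<lambda>i. if i = a then y else 0) = (\<Sum>i\<in>I. if i = a then y powr p else 0)"
      unfolding lp_mass_def using y p by (intro sum.cong) auto
    also have "\<dots> \<le> 1" using a y p assms by (simp add: powr_le1)
    finally obtain u where u: "u \<in> U" "lp_mass p I (\<lambda>i. (if i = a then y else 0) - u i) \<le> 0"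
      using U(2) by blast
    then have "\<bar>y - u a\<bar> powr p = 0"
      using a assms sum_nonneg_eq_0_iff[of I "\<lambda>i. \<bar>(if i = a then y else 0) - u i\<bar> powr p"]
      by (force simp: lp_mass_def intro: antisym sum_nonneg)
    then show "y \<in> (\<lambda>u. u a) ` U" using u by auto
  qed
  then have "finite {0..1::real}" by (rule finite_subset) (use U(1) in simp)
  then show False by (simp add: infinite_Icc)
qed

section \<open>From masses back to balls and the covering functional\<close>

lemma mem_lp_ball_iff: "x \<in> lp_ball p n \<longleftrightarrow> x \<in> carrier_vec n \<and> lp_mass p {..<n} (($) x) \<le> 1"
  by (simp add: lp_ball_def lp_mass_def)

lemma mem_scaled_lp_ball_iff:
  assumes p: "p > 0" and l: "l > 0" and y: "y \<in> carrier_vec n" and u: "u \<in> carrier_vec n"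
  shows "y \<in> (\<lambda>x. l \<cdot>\<^sub>v x + u) ` lp_ball p n \<longleftrightarrow>
    lp_mass p {..<n} (\<lambda>i. y $ i - u $ i) \<le> l powr p"
proof
  assume "y \<in> (\<lambda>x. l \<cdot>\<^sub>v x + u) ` lp_ball p n"
  then obtain x where x: "x \<in> lp_ball p n" "y = l \<cdot>\<^sub>v x + u" by blast
  then have x': "x \<in> carrier_vec n" "lp_mass p {..<n} (($) x) \<le> 1" by (auto simp: mem_lp_ball_iff)
  have "lp_mass p {..<n} (\<lambda>i. y $ i - u $ i) = lp_mass p {..<n} (\<lambda>i. l * x $ i)"
    using x x' u by (intro lp_mass_cong) auto
  also have "\<dots> = l powr p * lp_mass p {..<n} (($) x)" using l by (simp add: lp_mass_scale)
  also have "\<dots> \<le> l powr p * 1" using x' by (intro mult_left_mono) auto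
  finally show "lp_mass p {..<n} (\<lambda>i. y $ i - u $ i) \<le> l powr p" by simp
next
  assume le: "lp_mass p {..<n} (\<lambda>i. y $ i - u $ i) \<le> l powr p"
  define x where "x = (1 / l) \<cdot>\<^sub>v (y - u)"
  have x: "x \<in> carrier_vec n" using y u by (simp add: x_def)
  have "lp_mass p {..<n} (($) x) = lp_mass p {..<n} (\<lambda>i. (1 / l) * (y $ i - u $ i))"
    using y u by (intro lp_mass_cong) (auto simp: x_def)
  also have "\<dots> = lp_mass p {..<n} (\<lambda>i. y $ i - u $ i) / l powr p"
    using l by (subst lp_mass_scale) (simp add: powr_divide)
  also have "\<dots> \<le> 1" using le l by simp
  finally have "x \<in> lp_ball p n" using x by (simp add: mem_lp_ball_iff)
  moreover have "y = l \<cdot>\<^sub>v x + u" using y u l by (intro eq_vecI) (auto simp: x_def)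
  ultimately show "y \<in> (\<lambda>x. l \<cdot>\<^sub>v x + u) ` lp_ball p n" by blast
qed

lemma covered_by_translates_iff:
  assumes p: "p > 0" and l: "l > 0" and m: "m > 0"
  shows "covered_by_translates n m (lp_ball p n) l \<longleftrightarrow> lp_cover p {..<n} m (l powr p)"
proof
  assume "covered_by_translates n m (lp_ball p n) l"
  then obtain u where u: "\<And>i. i \<in> {1..m} \<Longrightarrow> u i \<in> carrier_vec n"
    "lp_ball p n \<subseteq> (\<Union>i\<in>{1..m}. (\<lambda>x. l \<cdot>\<^sub>v x + u i) ` lp_ball p n)"
    unfolding covered_by_translates_def by blast
  have "\<exists>v\<in>(\<lambda>j. ($) (u j)) ` {1..m}. lp_mass p {..<n} (\<lambda>i. x i - v i) \<le> l powr p"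
    if x: "lp_mass p {..<n} x \<le> 1" for x
  proof -
    have "lp_mass p {..<n} (($) (vec n x)) = lp_mass p {..<n} x" by (rule lp_mass_cong) simp
    then have "vec n x \<in> lp_ball p n" using x by (simp add: mem_lp_ball_iff)
    then obtain j where j: "j \<in> {1..m}" "vec n x \<in> (\<lambda>x. l \<cdot>\<^sub>v x + u j) ` lp_ball p n" using u by blast
    then have "lp_mass p {..<n} (\<lambda>i. vec n x $ i - u j $ i) \<le> l powr p"
      using mem_scaled_lp_ball_iff[OF p l, of "vec n x" n "u j"] u by simp
    also have "lp_mass p {..<n} (\<lambda>i. vec n x $ i - u j $ i) = lp_mass p {..<n} (\<lambda>i. x i - u j $ i)"
      by (rule lp_mass_cong) simp
    finally show ?thesis using j by blast
  qed
  moreover have "card ((\<lambda>j. ($) (u j)) ` {1..m}) \<le> m"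
    using card_image_le[of "{1..m}"] by simp
  ultimately show "lp_cover p {..<n} m (l powr p)" unfolding lp_cover_def by blast
next
  assume "lp_cover p {..<n} m (l powr p)"
  then obtain u where u: "\<And>x. lp_mass p {..<n} x \<le> 1 \<Longrightarrow>
      \<exists>j<m. lp_mass p {..<n} (\<lambda>i. x i - u (j, i)) \<le> l powr p"
    using lp_cover_iff_indexed[OF p _ m, of "{..<n}"] by auto
  \<comment> \<open>Translates are indexed by \<open>{1..m}\<close>, centers by
    \<open>j < m\<close>; hence the shift by one.\<close>
  define v where "v = (\<lambda>j. vec n (\<lambda>i. u (j - 1, i)))"
  have "y \<in> (\<Union>j\<in>{1..m}. (\<lambda>x. l \<cdot>\<^sub>v x + v j) ` lp_ball p n)" if y: "y \<in> lp_ball p n" for y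
  proof -
    obtain j where j: "j < m" "lp_mass p {..<n} (\<lambda>i. y $ i - u (j, i)) \<le> l powr p"
      using u y mem_lp_ball_iff by blast
    have "lp_mass p {..<n} (\<lambda>i. y $ i - v (Suc j) $ i) = lp_mass p {..<n} (\<lambda>i. y $ i - u (j, i))"
      by (rule lp_mass_cong) (simp add: v_def)
    then have "y \<in> (\<lambda>x. l \<cdot>\<^sub>v x + v (Suc j)) ` lp_ball p n"
      using mem_scaled_lp_ball_iff[OF p l, of y n "v (Suc j)"] j y by (simp add: v_def mem_lp_ball_iff)
    then show ?thesis using j by (intro UN_I[of "Suc j"]) auto
  qed
  then show "covered_by_translates n m (lp_ball p n) l"
    unfolding covered_by_translates_def by (intro exI[of _ v]) (auto simp: v_def)
qed

text \<open>Since \<open>l powr p\<close> increases with \<open>l\<close>, the least factor is the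
  \<open>p\<close>-th root of the least error. Attainment and positivity of that error make
  \<open>LEAST\<close> denote a genuine minimum.\<close>

lemma covering_functional_lp_ball:
  assumes p: "p > 0" and n: "n > 0" and m: "m > 0"
  shows "\<exists>r. 0 \<le> r \<and> r \<le> 1 \<and> lp_cover p {..<n} m r \<and>
    (\<forall>r'\<ge>0. lp_cover p {..<n} m r' \<longrightarrow> r \<le> r') \<and>
    covering_functional n m (lp_ball p n) = r powr (1/p)"
proof -
  obtain r where r: "0 \<le> r" "r \<le> 1" "lp_cover p {..<n} m r"
    "\<And>r'. 0 \<le> r' \<Longrightarrow> lp_cover p {..<n} m r' \<Longrightarrow> r \<le> r'"
    using lp_cover_minimum[OF p, of "{..<n}" m] m by blast
  have "r \<noteq> 0" using not_lp_cover_0[OF p, of "{..<n}" m] r(3) n by auto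
  then have "r > 0" using r by simp
  have "covering_functional n m (lp_ball p n) = r powr (1/p)"
    unfolding covering_functional_def
  proof (rule Least_equality)
    show "0 < r powr (1/p) \<and> covered_by_translates n m (lp_ball p n) (r powr (1/p))"
      using covered_by_translates_iff[OF p _ m] \<open>r > 0\<close> r(3) p by (simp add: powr_powr)
  next
    fix l assume l: "0 < l \<and> covered_by_translates n m (lp_ball p n) l"
    then have "r \<le> l powr p" using covered_by_translates_iff[OF p _ m] r(4)[of "l powr p"] by auto
    then have "r powr (1/p) \<le> (l powr p) powr (1/p)" using r p by (intro powr_mono2) auto
    then show "r powr (1/p) \<le> l" using l p by (simp add: powr_powr)
  qed
  then show ?thesis using r by (intro exI[of _ r]) simp
qed

section \<open>Convergence and the final estimate\<close>

text \<open>The limit is the infimum of all eventual upper bounds, that is, the limit superior. The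
  hypothesis makes \<open>f n + e\<close> such a bound for every large \<open>n\<close>, so
  \<open>f n\<close> cannot stay far below it.\<close>

lemma convergent_if_eventually_almost_decreasing:
  fixes f :: "nat \<Rightarrow> real"
  assumes b: "\<And>n. 0 \<le> f n"
    and d: "\<And>e. e > 0 \<Longrightarrow> \<exists>n0. \<forall>n\<ge>n0. \<exists>M0. \<forall>M\<ge>M0. f M \<le> f n + e"
  shows "convergent f"
proof -
  define A where "A = {a. \<exists>M0. \<forall>M\<ge>M0. f M \<le> a}"
  have A0: "0 \<le> a" if a: "a \<in> A" for a
  proof -
    obtain M where "\<forall>M'\<ge>M. f M' \<le> a" using a unfolding A_def by blast
    then have "f M \<le> a" by simp
    then show ?thesis using b[of M] by linarith
  qed
  have bdd: "bdd_below A" using A0 by (rule bdd_belowI)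
  have "A \<noteq> {}" using d[of 1] unfolding A_def by fastforce
  have "f \<longlonglongrightarrow> Inf A"
  proof (rule LIMSEQ_I)
    fix e :: real assume e: "e > 0"
    obtain a where "a \<in> A" "a < Inf A + e" using e cInf_lessD[OF \<open>A \<noteq> {}\<close>, of "Inf A + e"] by auto
    then obtain M0 where M0: "\<And>M. M \<ge> M0 \<Longrightarrow> f M < Inf A + e" unfolding A_def by force
    obtain n0 where n0: "\<And>n. n \<ge> n0 \<Longrightarrow> f n + e/2 \<in> A" using d[of "e/2"] e unfolding A_def by auto
    have "norm (f n - Inf A) < e" if "n \<ge> max M0 n0" for n
    proof -
      have "Inf A \<le> f n + e/2" using n0[of n] that bdd by (intro cInf_lower) auto
      moreover have "f n < Inf A + e" using M0[of n] that by simp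
      ultimately show ?thesis using e by (simp add: abs_less_iff)
    qed
    then show "\<exists>N. \<forall>n\<ge>N. norm (f n - Inf A) < e" by blast
  qed
  then show ?thesis by (auto simp: convergent_def)
qed

theorem theorem1p4:
  fixes p :: real
  assumes "p \<ge> 1"
  shows "\<exists>c2::real. c3 \<le> c2 \<and> c2 \<le> c4 \<and>
           (\<exists>L. (\<lambda>n. covering_functional n (2 ^ n) (lp_ball p n)) \<longlonglongrightarrow> L \<and>
                L \<le> (1 / (1 + c2)) powr (1 / p))"
proof -
  have p: "p > 0" using assms by simp
  define Q where "Q = (\<lambda>n r. 0 \<le> r \<and> r \<le> 1 \<and> lp_cover p {..<n} (2 ^ n) r \<and>
      (\<forall>r'\<ge>0. lp_cover p {..<n} (2 ^ n) r' \<longrightarrow> r \<le> r') \<and>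
      covering_functional n (2 ^ n) (lp_ball p n) = r powr (1/p))"
  \<comment> \<open>Dimension 0 is left out of \<open>Q\<close>; there \<open>f\<close> is merely
    nonnegative, which suffices for the convergence lemma.\<close>
  have "\<exists>r. 0 \<le> r \<and> (n > 0 \<longrightarrow> Q n r)" for n
  proof (cases "n > 0")
    case True
    have "\<exists>r. Q n r" unfolding Q_def by (rule covering_functional_lp_ball[OF p True]) simp
    then obtain r where "Q n r" by blast
    then show ?thesis by (intro exI[of _ r]) (simp add: Q_def)
  qed (intro exI[of _ 0], simp)
  then obtain f where f0: "\<And>n. 0 \<le> f n" and Q: "\<And>n. n > 0 \<Longrightarrow> Q n (f n)" by metis
  have f: "f n \<le> 1" "lp_cover p {..<n} (2 ^ n) (f n)"
    "covering_functional n (2 ^ n) (lp_ball p n) = f n powr (1/p)" if "n > 0" for n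
    using Q[OF that] unfolding Q_def by blast+
  have f_min: "f n \<le> r" if "n > 0" "0 \<le> r" "lp_cover p {..<n} (2 ^ n) r" for n r
    using Q[OF that(1)] that(2,3) unfolding Q_def by blast
  have "convergent f"
  proof (rule convergent_if_eventually_almost_decreasing)
    fix e :: real assume "e > 0"
    obtain k where k: "k > 0" "inverse (real k) < e / 2"
      using ex_inverse_of_nat_less[of "e / 2"] \<open>e > 0\<close> by auto
    then have k2: "2 / k < e" by (simp add: field_simps)
    have "f M \<le> f n + e" if n: "n \<ge> 2 * k * (k + 3)" and M: "M \<ge> 4 * k * (n + k + 3)" for n M
    proof -
      have "0 < 2 * k * (k + 3)" "0 < 4 * k * (n + k + 3)" using k by auto
      then have "n > 0" "M > 0" using n M by linarith+
      then have "f M \<le> f n + 2 / k"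
        using lp_cover_extend[OF p k(1) n M f0 f(1,2)] f0[of n] by (intro f_min) auto
      then show ?thesis using k2 by simp
    qed
    then show "\<exists>n0. \<forall>n\<ge>n0. \<exists>M0. \<forall>M\<ge>M0. f M \<le> f n + e" by blast
  qed (rule f0)
  then obtain r where r: "f \<longlonglongrightarrow> r" by (auto simp: convergent_def)
  have r0: "0 \<le> r" using r f0 by (intro LIMSEQ_le_const) auto
  \<comment> \<open>The lattice covering is compared with \<open>f\<close> in the limit;
    \<open>c3\<close> is the witness for \<open>c2\<close>.\<close>
  have "r \<le> 1 / (1 + c3)"
  proof (rule LIMSEQ_le[OF r])
    have c3: "c3 > 0" by (rule c3_props)
    have "(\<lambda>n. 1 / (1 + (nat \<lfloor>c3 * real n\<rfloor>) / n)) \<longlonglongrightarrow> 1 / (1 + c3)"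
    proof (intro tendsto_intros)
      show "(\<lambda>n. real (nat \<lfloor>c3 * real n\<rfloor>) / n) \<longlonglongrightarrow> c3"
      proof (rule tendsto_sandwich)
        show "(\<lambda>n. c3 - inverse (real n)) \<longlonglongrightarrow> c3"
          using tendsto_diff[OF tendsto_const lim_inverse_n, of c3] by simp
        show "\<forall>\<^sub>F n in sequentially. c3 - inverse (real n) \<le> real (nat \<lfloor>c3 * real n\<rfloor>) / n"
          using eventually_gt_at_top[of 0]
        proof eventually_elim
          case (elim n)
          have "c3 * n - 1 \<le> real (nat \<lfloor>c3 * real n\<rfloor>)" by linarith
          then have "(c3 * n - 1) / n \<le> real (nat \<lfloor>c3 * real n\<rfloor>) / n"
            by (rule divide_right_mono) simp
          then show ?case using elim by (simp add: diff_divide_distrib inverse_eq_divide)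
        qed
        show "\<forall>\<^sub>F n in sequentially. real (nat \<lfloor>c3 * real n\<rfloor>) / n \<le> c3"
          using eventually_gt_at_top[of 0]
        proof eventually_elim
          case (elim n)
          have "real (nat \<lfloor>c3 * real n\<rfloor>) \<le> c3 * n" using c3 by simp
          then show ?case using elim by (simp add: field_simps)
        qed
      qed (rule tendsto_const)
    qed (use c3 in auto)
    then show "(\<lambda>n. 1 / (1 + (nat \<lfloor>c3 * real n\<rfloor>) / n)) \<longlonglongrightarrow> 1 / (1 + c3)" .
    have "f n \<le> 1 / (1 + (nat \<lfloor>c3 * real n\<rfloor>) / n)" if "n \<ge> 1" for n
    proof -
      have "f n \<le> n / (n + nat \<lfloor>c3 * n\<rfloor>)"
        using lp_cover_c3[OF assms, of n] that by (intro f_min) auto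
      also have "\<dots> = 1 / (1 + (nat \<lfloor>c3 * real n\<rfloor>) / n)"
        using that by (simp add: field_simps)
      finally show ?thesis .
    qed
    then show "\<exists>N. \<forall>n\<ge>N. f n \<le> 1 / (1 + (nat \<lfloor>c3 * real n\<rfloor>) / n)" by blast
  qed
  then have "r powr (1/p) \<le> (1 / (1 + c3)) powr (1/p)" using r0 p by (intro powr_mono2) auto
  moreover have "(\<lambda>n. f n powr (1/p)) \<longlonglongrightarrow> r powr (1/p)"
    using r f0 p by (intro tendsto_powr') auto
  then have "(\<lambda>n. covering_functional n (2 ^ n) (lp_ball p n)) \<longlonglongrightarrow> r powr (1/p)"
    by (rule Lim_transform_eventually)
      (use eventually_gt_at_top[of 0] in eventually_elim, simp add: f(3))
  \<comment> \<open>The numerical enclosures separate the constants: \<open>c3 < 0.2059\<close> and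
    \<open>0.2266 < c4\<close>.\<close>
  moreover have "c3 \<le> c4" using c3_props(4) c4_props(4) by simp
  ultimately show ?thesis by blast
qed

end
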